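(* If $F$ is a forest, then $\alpha'_g(F)\ge\frac{3}{4}\alpha'(F)$.
   Context: Graphs are finite and simple. $\alpha'(G)$ denotes the maximum size of a matching in $G$. The matching game on a graph $G$: two players, Max and Min, alternately add edges of $G$ to a set of chosen edges that must always remain a matching; the game ends when the chosen edges form a maximal matching of $G$ (no further edge can be added). Max wants the final matching to be large, Min wants it to be small. $\alpha'_g(G)$ denotes the size of the final matching under optimal play when Max moves first. *)

theory Defs
  imports Complex_Main "HOL-Library.Ramsey"
begin

definition fin_simple_graph :: "'a set \<Rightarrow> 'a set set \<Rightarrow> bool" where
  "fin_simple_graph V E \<longleftrightarrow> finite V \<and> E \<subseteq> nsets V 2"

text \<open>A cycle is given by the list of its vertices, without repeating the first one at the end.\<close>

definition is_cycle :: "'a set set \<Rightarrow> 'a list \<Rightarrow> bool" where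
  "is_cycle E vs \<longleftrightarrow> 3 \<le> length vs \<and> distinct vs \<and>
     (\<forall>i < length vs. {vs ! i, vs ! (Suc i mod length vs)} \<in> E)"

definition forest :: "'a set \<Rightarrow> 'a set set \<Rightarrow> bool" where
  "forest V E \<longleftrightarrow> fin_simple_graph V E \<and> (\<nexists>vs. is_cycle E vs)"

definition matching :: "'a set set \<Rightarrow> 'a set set \<Rightarrow> bool" where
  "matching E M \<longleftrightarrow> M \<subseteq> E \<and> pairwise disjnt M"

definition matching_number :: "'a set set \<Rightarrow> nat" where
  "matching_number E = Max (card ` {M. matching E M})"

text \<open>A position of the matching game is the set \<open>M\<close> of edges chosen so far; it admits no
  legal move precisely when \<open>M\<close> is a maximal matching.\<close>

definition legal_moves :: "'a set set \<Rightarrow> 'a set set \<Rightarrow> 'a set set" where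
  "legal_moves E M = {e \<in> E - M. matching E (insert e M)}"

lemma card_legal_move_less:
  assumes "finite E" and "e \<in> legal_moves E M"
  shows "card (E - insert e M) < card (E - M)"
  using assms by (intro psubset_card_mono) (auto simp: legal_moves_def)

datatype player = Maximizer | Minimizer

text \<open>The size of the final matching under optimal play from position \<open>M\<close> when player \<open>p\<close> is to
  move, by backward induction. The test \<open>finite E\<close> only serves to make the recursion terminate.\<close>

function game_value :: "'a set set \<Rightarrow> player \<Rightarrow> 'a set set \<Rightarrow> nat" where
  "game_value E p M =
     (if finite E \<and> legal_moves E M \<noteq> {} then
        (case p of
           Maximizer \<Rightarrow> Max ((\<lambda>e. game_value E Minimizer (insert e M)) ` legal_moves E M)
         | Minimizer \<Rightarrow> Min ((\<lambda>e. game_value E Maximizer (insert e M)) ` legal_moves E M))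
      else card M)"
  by pat_completeness auto
termination
  by (relation "measure (\<lambda>(E, p, M). card (E - M))") (simp_all add: card_legal_move_less)

declare game_value.simps [simp del]

definition game_matching_number :: "'a set set \<Rightarrow> nat" where
  "game_matching_number E = game_value E Maximizer {}"

end

theory Submission
  imports Defs
begin

text \<open>After deleting the endpoints of the chosen edges, a forest remains; some of its components
  are stars, and each star contributes exactly one edge to the final matching, however the game
  goes. Let \<open>U\<close> be the rest of the remaining forest. If \<open>U\<close> is not a union of stars, then
  Maximizer has a move \<open>{w, q}\<close> in \<open>U\<close> that splits off at least one new star without wasting
  anything: if \<open>b\<close> stars are split off, the matching number of \<open>U\<close> drops by at most \<open>1 + b\<close>.
  A move of Minimizer in \<open>U\<close> costs at most \<open>2\<close>. Hence the quantity
  \<open>4 \<cdot> (chosen edges) + 4 \<cdot> (stars) + 3 \<cdot> (matching number of U)\<close> increases by at least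
  \<open>4 + 4b - 3(1 + b) \<ge> 2\<close> with each such move of Maximizer and decreases by at most
  \<open>3 \<cdot> 2 - 4 = 2\<close> with the answer of Minimizer.

  The vertex \<open>w\<close> is a leaf of the forest obtained by deleting leaves twice, so all neighbours
  of \<open>w\<close> but one are leaves or centers of stars hanging at \<open>w\<close>.\<close>

section \<open>Leaves, peeling and star components\<close>

definition pendant :: "'a set set \<Rightarrow> 'a \<Rightarrow> 'a \<Rightarrow> bool" where
  "pendant U x y \<longleftrightarrow> {x, y} \<in> U \<and> (\<forall>f\<in>U. x \<in> f \<longrightarrow> f = {x, y})"

definition is_leaf :: "'a set set \<Rightarrow> 'a \<Rightarrow> bool" where
  "is_leaf U x \<longleftrightarrow> (\<exists>y. pendant U x y)"

text \<open>One round of deleting all leaves simultaneously. With graphs given by their edges,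
  vertices left isolated vanish, so for a simple graph \<open>peel U = {}\<close> says that every
  component is a star.\<close>

definition peel :: "'a set set \<Rightarrow> 'a set set" where
  "peel U = {f \<in> U. \<forall>x\<in>f. \<not> is_leaf U x}"

text \<open>Each vertex of \<open>A\<close> is the center of a component of \<open>R\<close> that is a star, and different
  vertices of \<open>A\<close> lie in different components (an isolated edge has only one of its two possible
  centers in \<open>A\<close>).\<close>

definition stars :: "'a set set \<Rightarrow> 'a set \<Rightarrow> bool" where
  "stars R A \<longleftrightarrow> (\<forall>a\<in>A. (\<exists>e\<in>R. a \<in> e) \<and>
     (\<forall>e\<in>R. a \<in> e \<longrightarrow> e \<inter> A = {a} \<and> (\<forall>f\<in>R. f \<inter> e \<noteq> {} \<longrightarrow> a \<in> f)))"

text \<open>Vertex deletion, used both for the ends of a chosen edge and for a set of star centers;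
  the latter removes whole stars, since every edge of a star contains its center.\<close>

definition avoiding :: "'a set set \<Rightarrow> 'a set \<Rightarrow> 'a set set" where
  "avoiding R A = {f \<in> R. disjnt f A}"

lemma avoiding_avoiding: "avoiding (avoiding R A) B = avoiding R (A \<union> B)"
  by (auto simp: avoiding_def disjnt_def)

lemma avoiding_subset: "avoiding R A \<subseteq> R"
  by (auto simp: avoiding_def)

lemma peel_subset: "peel U \<subseteq> U"
  by (auto simp: peel_def)

section \<open>Leaves of a finite forest\<close>

lemma edge_with_endpoint:
  assumes "card e = 2" "x \<in> e"
  obtains y where "e = {x, y}" "x \<noteq> y"
  using assms by (auto simp: card_2_iff)

text \<open>If the first vertex of a longest path is not a leaf, it has a second neighbour; by
  maximality that neighbour lies on the path and closes a cycle.\<close>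

lemma exists_leaf:
  assumes "finite U" "U \<noteq> {}" and two: "\<forall>e\<in>U. card e = 2"
    and acyclic: "\<nexists>vs. is_cycle U vs"
  shows "\<exists>x. is_leaf U x"
proof (rule ccontr)
  assume no_leaf: "\<not> ?thesis"
  define path where
    "path vs \<longleftrightarrow> 2 \<le> length vs \<and> distinct vs \<and> (\<forall>i. Suc i < length vs \<longrightarrow> {vs ! i, vs ! Suc i} \<in> U)"
    for vs
  have fin: "finite (\<Union>U)"
    using assms(1) two by (metis card.infinite finite_Union zero_neq_numeral)
  obtain e where "e \<in> U" using assms(2) by blast
  then obtain a b where "e = {a, b}" "a \<noteq> b"
    using two by (meson card_2_iff)
  then have "path [a, b]"
    using \<open>e \<in> U\<close> by (auto simp: path_def less_Suc_eq)
  have bound: "length vs < Suc (card (\<Union>U))" if "path vs" for vs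
  proof -
    have "set vs \<subseteq> \<Union>U"
    proof
      fix v assume "v \<in> set vs"
      then obtain i where i: "i < length vs" "v = vs ! i" by (metis in_set_conv_nth)
      show "v \<in> \<Union>U"
      proof (cases "Suc i < length vs")
        case True
        then show ?thesis using that i by (auto simp: path_def)
      next
        case False
        then have "Suc (i - 1) < length vs" "Suc (i - 1) = i" using that i by (auto simp: path_def)
        then have "{vs ! (i - 1), vs ! i} \<in> U" using that by (metis path_def)
        then show ?thesis using i by auto
      qed
    qed
    then show ?thesis
      using that fin by (metis card_mono distinct_card less_Suc_eq_le path_def)
  qed
  obtain vs where vs: "path vs" and longest: "\<And>ws. path ws \<Longrightarrow> length ws \<le> length vs"
    using ex_has_greatest_nat[of path, OF \<open>path [a, b]\<close>, of length "Suc (card (\<Union>U))"] bound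
    by (meson less_imp_le)
  have len: "2 \<le> length vs" and dist: "distinct vs"
    and adj: "\<And>i. Suc i < length vs \<Longrightarrow> {vs ! i, vs ! Suc i} \<in> U"
    using vs by (auto simp: path_def)
  have "{vs ! 0, vs ! 1} \<in> U" using adj[of 0] len by simp
  then obtain f where f: "f \<in> U" "vs ! 0 \<in> f" "f \<noteq> {vs ! 0, vs ! 1}"
    using no_leaf by (auto simp: is_leaf_def pendant_def)
  then obtain y where y: "f = {vs ! 0, y}" "vs ! 0 \<noteq> y"
    using two by (meson edge_with_endpoint)
  have "y \<in> set vs"
  proof (rule ccontr)
    assume "y \<notin> set vs"
    then have "path (y # vs)"
      using vs f(1) y by (auto simp: path_def nth_Cons insert_commute split: nat.split)
    then show False using longest by fastforce
  qed
  then obtain j where j: "j < length vs" "vs ! j = y" by (metis in_set_conv_nth)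
  \<comment> \<open>The index 1 is excluded because \<open>f\<close> is not the first edge of the
    path; so the segment closed by \<open>f\<close> has at least three vertices.\<close>
  then have "j \<noteq> 0" "j \<noteq> 1" using f y by auto
  then have "2 \<le> j" by simp
  have "is_cycle U (take (Suc j) vs)"
    unfolding is_cycle_def
  proof (intro conjI allI impI)
    show "3 \<le> length (take (Suc j) vs)" using j \<open>2 \<le> j\<close> by simp
    show "distinct (take (Suc j) vs)" using dist by simp
    have len_take: "length (take (Suc j) vs) = Suc j" using j by simp
    fix i assume "i < length (take (Suc j) vs)"
    then consider "i < j" | "i = j" using len_take by linarith
    then show "{take (Suc j) vs ! i, take (Suc j) vs ! (Suc i mod length (take (Suc j) vs))} \<in> U"
      unfolding len_take using j f(1) y adj[of i] by cases (auto simp: insert_commute)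
  qed
  then show False using acyclic by blast
qed

lemma is_cycle_mono: "is_cycle U vs \<Longrightarrow> U \<subseteq> W \<Longrightarrow> is_cycle W vs"
  by (auto simp: is_cycle_def)

lemma peel_finite_acyclic:
  "finite U \<Longrightarrow> finite (peel U)"
  "\<forall>e\<in>U. card e = 2 \<Longrightarrow> \<forall>e\<in>peel U. card e = 2"
  "\<nexists>vs. is_cycle U vs \<Longrightarrow> \<nexists>vs. is_cycle (peel U) vs"
  using finite_subset[OF peel_subset, of U] is_cycle_mono[OF _ peel_subset, of U]
  by (auto simp: peel_def)

section \<open>Matching numbers and covers\<close>

lemma finite_matchings: "finite E \<Longrightarrow> finite {M. matching E M}"
  by (rule finite_subset[of _ "Pow E"]) (auto simp: matching_def)

lemma matching_empty: "matching E {}"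
  by (auto simp: matching_def)

lemma card_le_matching_number:
  assumes "finite E" "matching E M"
  shows "card M \<le> matching_number E"
  unfolding matching_number_def using assms by (intro Max_ge) (auto simp: finite_matchings)

lemma matching_number_attained:
  assumes "finite E"
  obtains M where "matching E M" "card M = matching_number E"
proof -
  have "Max (card ` {M. matching E M}) \<in> card ` {M. matching E M}"
    using assms matching_empty by (intro Max_in) (auto simp: finite_matchings)
  then show thesis using that by (auto simp: matching_number_def)
qed

lemma matching_number_empty [simp]: "matching_number {} = 0"
  by (rule matching_number_attained[of "{}"]) (auto simp: matching_def)

text \<open>In a maximum matching of \<open>U\<close>, the edges outside \<open>W\<close> are
  pairwise disjoint, so each uses up its own vertex of \<open>K\<close>. Every upper bound on a loss
  of matching number below comes from here.\<close>

lemma matching_number_le_cover: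
  assumes "finite U" "W \<subseteq> U" "finite K"
    and cover: "\<And>f. f \<in> U \<Longrightarrow> f \<notin> W \<Longrightarrow> \<not> disjnt f K"
  shows "matching_number U \<le> card K + matching_number W"
proof -
  obtain M where M: "matching U M" "card M = matching_number U"
    using matching_number_attained assms(1) by blast
  have finM: "finite M" using M(1) assms(1) by (auto simp: matching_def intro: finite_subset)
  have "matching W (M \<inter> W)"
    using M(1) by (auto simp: matching_def pairwise_def)
  then have W: "card (M \<inter> W) \<le> matching_number W"
    using assms(1,2) card_le_matching_number finite_subset by blast
  have "\<exists>x. x \<in> f \<and> x \<in> K" if "f \<in> M - W" for f
    using that M(1) cover[of f] by (auto simp: matching_def disjnt_def)
  then obtain g where g: "\<And>f. f \<in> M - W \<Longrightarrow> g f \<in> f \<and> g f \<in> K" by metis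
  have "inj_on g (M - W)"
  proof (rule inj_onI)
    fix e f assume ef: "e \<in> M - W" "f \<in> M - W" "g e = g f"
    then have "g e \<in> e \<inter> f" using g by (metis IntI)
    then show "e = f"
      using M(1) ef by (auto simp: matching_def pairwise_def disjnt_def)
  qed
  then have "card (M - W) \<le> card K"
    using g assms(3) by (metis card_inj_on_le image_subsetI)
  moreover have "card M = card (M \<inter> W) + card (M - W)"
    using finM by (metis card_Int_Diff)
  ultimately show ?thesis using W M(2) by linarith
qed

section \<open>Splitting off stars\<close>

lemma peeled_edge:
  assumes two: "\<forall>e\<in>U. card e = 2"
    and "f \<in> U" "f \<notin> peel U" "v \<in> f" "\<not> is_leaf U v"
  obtains x where "f = {v, x}" "v \<noteq> x" "is_leaf U x"
proof -
  obtain x where "f = {v, x}" "v \<noteq> x" using edge_with_endpoint assms by metis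
  then show thesis using that assms by (auto simp: peel_def)
qed

lemma is_leafD: "is_leaf U x \<Longrightarrow> f \<in> U \<Longrightarrow> g \<in> U \<Longrightarrow> x \<in> f \<Longrightarrow> x \<in> g \<Longrightarrow> f = g"
  by (auto simp: is_leaf_def pendant_def)

lemma is_leaf_pendant: "is_leaf U x \<Longrightarrow> {x, y} \<in> U \<Longrightarrow> pendant U x y"
  unfolding pendant_def by (metis insertI1 is_leafD)

lemma not_leaf_other_edge:
  assumes two: "\<forall>e\<in>U. card e = 2"
    and "f \<in> U" "v \<in> f" "\<not> is_leaf U v"
  obtains g where "g \<in> U" "v \<in> g" "g \<noteq> f"
proof -
  obtain y where "f = {v, y}" using edge_with_endpoint assms by metis
  then show thesis using that assms by (auto simp: is_leaf_def pendant_def)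
qed

lemma peel_not_leaf: "f \<in> peel U \<Longrightarrow> v \<in> f \<Longrightarrow> \<not> is_leaf U v"
  by (auto simp: peel_def)

text \<open>The neighbour \<open>v\<close> of any leaf can serve as a center, even in an isolated
  edge, and \<open>{v}\<close> covers all edges that are deleted.\<close>

lemma star_forest_split:
  assumes "finite U" "U \<noteq> {}" and two: "\<forall>e\<in>U. card e = 2"
    and acyclic: "\<nexists>vs. is_cycle U vs" and "peel U = {}"
  shows "\<exists>v. stars U {v} \<and> matching_number U \<le> 1 + matching_number (avoiding U {v})"
proof -
  obtain x v where x: "pendant U x v"
    using exists_leaf[OF assms(1,2) two acyclic] by (auto simp: is_leaf_def)
  have "stars U {v}"
    unfolding stars_def
  proof (intro ballI conjI impI)
    fix a assume "a \<in> {v}"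
    then have [simp]: "a = v" by simp
    show "\<exists>e\<in>U. a \<in> e" using x by (auto simp: pendant_def)
    fix e assume e: "e \<in> U" "a \<in> e"
    then show "e \<inter> {v} = {a}" by auto
    fix f assume f: "f \<in> U" "f \<inter> e \<noteq> {}"
    show "a \<in> f"
    proof (cases "is_leaf U v")
      case True
      then have "e = {x, v}" using is_leafD[OF True] e x by (auto simp: pendant_def)
      then show ?thesis using f x by (auto simp: pendant_def)
    next
      case False
      then obtain y where "e = {v, y}" "is_leaf U y"
        using peeled_edge[OF two, of e v] e assms(5) by auto
      then show ?thesis using f e is_leafD[of U y e f] by auto
    qed
  qed
  moreover have "matching_number U \<le> card {v} + matching_number (avoiding U {v})"
    using assms(1) by (intro matching_number_le_cover) (auto simp: avoiding_def)
  ultimately show ?thesis by auto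
qed

text \<open>If \<open>peel U\<close> is empty, \<open>z\<close> is itself one of the vertices \<open>v\<close> pendant at \<open>w\<close>.\<close>

lemma second_layer:
  assumes "finite U" and two: "\<forall>e\<in>U. card e = 2"
    and acyclic: "\<nexists>vs. is_cycle U vs" and "U \<noteq> {}"
  shows "\<exists>w z. {w, z} \<in> U \<and> (\<exists>v. pendant U v w) \<and>
           (\<forall>f\<in>U. w \<in> f \<longrightarrow> f = {w, z} \<or> (\<exists>v. pendant U v w \<and> f = {v, w}))"
proof (cases "peel U = {}")
  case True
  obtain v w where v: "pendant U v w"
    using exists_leaf[OF assms(1,4) two acyclic] by (auto simp: is_leaf_def)
  have *: "f = {w, v} \<or> (\<exists>v. pendant U v w \<and> f = {v, w})" if f: "f \<in> U" "w \<in> f" for f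
  proof (cases "is_leaf U w")
    case True
    then show ?thesis using is_leafD[OF True, of f "{v, w}"] f v by (auto simp: pendant_def)
  next
    case False
    then obtain y where "f = {w, y}" "is_leaf U y"
      using peeled_edge[OF two, of f w] f True by auto
    then show ?thesis using f is_leaf_pendant[of U y w] by (auto simp: insert_commute)
  qed
  have "{w, v} \<in> U" using v by (simp add: pendant_def insert_commute)
  then show ?thesis using v * by blast
next
  case False
  have sub: "peel U \<subseteq> U" by (rule peel_subset)
  obtain w z where w: "pendant (peel U) w z"
    using exists_leaf[OF peel_finite_acyclic(1)[OF assms(1)] False peel_finite_acyclic(2,3)] two acyclic
    unfolding is_leaf_def by blast
  then have wz: "{w, z} \<in> peel U" "{w, z} \<in> U" using sub by (auto simp: pendant_def)
  then have nl: "\<not> is_leaf U w" using peel_not_leaf by fastforce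
  have *: "\<exists>v. pendant U v w \<and> f = {v, w}" if f: "f \<in> U" "w \<in> f" "f \<noteq> {w, z}" for f
  proof -
    have "f \<notin> peel U" using w f by (auto simp: pendant_def)
    then obtain y where "f = {w, y}" "is_leaf U y"
      using peeled_edge[OF two] f nl by metis
    then show ?thesis using f is_leaf_pendant[of U y w] by (auto simp: insert_commute)
  qed
  obtain g where "g \<in> U" "w \<in> g" "g \<noteq> {w, z}"
    using not_leaf_other_edge[OF two wz(2), of w] nl by blast
  then show ?thesis using * wz by blast
qed

text \<open>The move of Maximizer: \<open>second_layer\<close> is applied to \<open>peel U\<close>,
  and \<open>B\<close> consists of the centers of the stars split off when \<open>w\<close>
  disappears.\<close>

lemma forest_split:
  assumes "finite U" "peel U \<noteq> {}" and two: "\<forall>e\<in>U. card e = 2"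
    and acyclic: "\<nexists>vs. is_cycle U vs"
  shows "\<exists>e\<in>U. \<exists>B. finite B \<and> B \<noteq> {} \<and> stars (avoiding U e) B \<and>
           matching_number U \<le> 1 + card B + matching_number (avoiding (avoiding U e) B)"
proof -
  have sub: "peel U \<subseteq> U" by (rule peel_subset)
  obtain w z where wz: "{w, z} \<in> peel U" and ex: "\<exists>v. pendant (peel U) v w"
    and nbrs: "\<And>f. f \<in> peel U \<Longrightarrow> w \<in> f \<Longrightarrow> f = {w, z} \<or> (\<exists>v. pendant (peel U) v w \<and> f = {v, w})"
    using second_layer[OF peel_finite_acyclic(1)[OF assms(1)] peel_finite_acyclic(2)[OF two]
        peel_finite_acyclic(3)[OF acyclic] assms(2)] by blast
  define B where "B = {v. pendant (peel U) v w}"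
  have B_edge: "{v, w} \<in> peel U" "{v, w} \<in> U" "v \<noteq> w" "\<not> is_leaf U v" if "v \<in> B" for v
  proof -
    show *: "{v, w} \<in> peel U" using that by (auto simp: B_def pendant_def)
    then show **: "{v, w} \<in> U" using sub by blast
    then show "v \<noteq> w" using two by fastforce
    show "\<not> is_leaf U v" using * peel_not_leaf by fastforce
  qed
  have w_nl: "\<not> is_leaf U w" using wz peel_not_leaf by fastforce
  have B_nbr: "\<exists>x. f = {v, x} \<and> v \<noteq> x \<and> is_leaf U x" if "v \<in> B" "f \<in> U" "v \<in> f" "f \<noteq> {v, w}" for f v
  proof -
    have "f \<notin> peel U" using that by (auto simp: B_def pendant_def)
    then show ?thesis using peeled_edge[OF two] that B_edge by metis
  qed
  have finB: "finite B"
  proof (rule finite_subset)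
    show "B \<subseteq> \<Union>U" using B_edge by blast
    show "finite (\<Union>U)" using assms(1) two by (metis card.infinite finite_Union zero_neq_numeral)
  qed
  \<comment> \<open>The vertex \<open>z\<close> may itself belong to \<open>B\<close>, and a center
    that is an end of the move is lost; hence \<open>B - {q}\<close>.\<close>
  have star: "stars (avoiding U {w, q}) (B - {q})" if q: "{w, q} \<in> U" for q
    unfolding stars_def
  proof (intro ballI conjI impI)
    fix v assume v: "v \<in> B - {q}"
    obtain g where g: "g \<in> U" "v \<in> g" "g \<noteq> {v, w}"
      using not_leaf_other_edge[OF two, of "{v, w}" v] B_edge v by blast
    then obtain x where x: "g = {v, x}" "is_leaf U x" using B_nbr v by blast
    \<comment> \<open>The star at \<open>v\<close> keeps an edge: if \<open>x\<close> were
      \<open>q\<close>, this leaf would lie on both \<open>g\<close> and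
      \<open>{w, q}\<close>.\<close>
    have "x \<noteq> q"
    proof
      assume "x = q"
      then have "{w, q} = g" using is_leafD[OF x(2) q g(1)] x by auto
      then show False using x g v \<open>x = q\<close> B_edge(3)[of v] by (auto simp: doubleton_eq_iff)
    qed
    moreover have "x \<noteq> w" using x w_nl by auto
    ultimately have "g \<in> avoiding U {w, q}"
      using g x v B_edge by (auto simp: avoiding_def disjnt_def)
    then show "\<exists>e\<in>avoiding U {w, q}. v \<in> e" using g by blast
    fix e assume e: "e \<in> avoiding U {w, q}" "v \<in> e"
    then have "e \<in> U" "e \<noteq> {v, w}" by (auto simp: avoiding_def)
    then obtain y where y: "e = {v, y}" "is_leaf U y" using B_nbr e v by blast
    show "e \<inter> (B - {q}) = {v}" using y v B_edge by auto
    fix f assume "f \<in> avoiding U {w, q}" "f \<inter> e \<noteq> {}"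
    then show "v \<in> f" using is_leafD[OF y(2) \<open>e \<in> U\<close>, of f] y by (auto simp: avoiding_def)
  qed
  \<comment> \<open>Maximizer plays the pendant edge at \<open>w\<close> if there is one, and otherwise \<open>{w, z}\<close>.\<close>
  have "\<exists>q k. {w, q} \<in> U \<and> B - {q} \<noteq> {} \<and>
      (\<forall>f\<in>U. \<not> disjnt f {w, q} \<longrightarrow> \<not> disjnt f (insert k (B - {q})))"
  proof (cases "\<exists>y. {w, y} \<in> U \<and> is_leaf U y")
    case True
    then obtain y where y: "{w, y} \<in> U" "is_leaf U y" by blast
    then have "y \<notin> B" using B_edge by blast
    then have "B - {y} \<noteq> {}" using ex by (auto simp: B_def)
    \<comment> \<open>As \<open>y\<close> is a leaf, every edge meeting the move contains
      \<open>w\<close>; this is the choice \<open>k = w\<close>.\<close>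
    moreover have "w \<in> f" if "f \<in> U" "\<not> disjnt f {w, y}" for f
      using that is_leafD[OF y(2) y(1), of f] by (auto simp: disjnt_def)
    ultimately show ?thesis using y by (intro exI[of _ y] exI[of _ w]) auto
  next
    case False
    have w_edge: "f = {w, z} \<or> (\<exists>v\<in>B. f = {v, w})" if f: "f \<in> U" "w \<in> f" for f
    proof -
      have "f \<in> peel U"
        using peeled_edge[OF two f(1) _ f(2) w_nl] False f(1) by metis
      then show ?thesis using nbrs f by (auto simp: B_def)
    qed
    have "{w, z} \<in> U" using wz sub by blast
    then obtain g where g: "g \<in> U" "w \<in> g" "g \<noteq> {w, z}"
      using not_leaf_other_edge[OF two, of "{w, z}" w] w_nl by blast
    then have "B - {z} \<noteq> {}" using w_edge[of g] by auto
    \<comment> \<open>Here every edge at \<open>w\<close> leads to \<open>z\<close> or into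
      \<open>B\<close>, so \<open>w\<close> need not be in the cover and \<open>k = z\<close>
      suffices.\<close>
    moreover have "\<not> disjnt f (insert z (B - {z}))" if "f \<in> U" "\<not> disjnt f {w, z}" for f
      using that w_edge[of f] by (auto simp: disjnt_def)
    ultimately show ?thesis using \<open>{w, z} \<in> U\<close> by blast
  qed
  then obtain q k where q: "{w, q} \<in> U" "B - {q} \<noteq> {}"
    and cover: "\<And>f. f \<in> U \<Longrightarrow> \<not> disjnt f {w, q} \<Longrightarrow> \<not> disjnt f (insert k (B - {q}))"
    by blast
  \<comment> \<open>The set \<open>insert k (B - {q})\<close> meets the edges destroyed by the move
    as well as those in the new stars.\<close>
  have "matching_number U \<le>
      card (insert k (B - {q})) + matching_number (avoiding (avoiding U {w, q}) (B - {q}))"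
    using assms(1) finB cover
    by (intro matching_number_le_cover) (auto simp: avoiding_def disjnt_def)
  also have "card (insert k (B - {q})) \<le> 1 + card (B - {q})"
    by (metis card_insert_le_m1 add.commute card_insert_if finB finite_Diff le_add2 order_refl plus_1_eq_Suc)
  finally show ?thesis using q star finB by (metis add_le_mono1 finite_Diff)
qed

section \<open>Star centers under union and under moves\<close>

lemma stars_edge: "stars R A \<Longrightarrow> a \<in> A \<Longrightarrow> \<exists>e\<in>R. a \<in> e"
  unfolding stars_def by blast

lemma stars_Int: "stars R A \<Longrightarrow> a \<in> A \<Longrightarrow> e \<in> R \<Longrightarrow> a \<in> e \<Longrightarrow> e \<inter> A = {a}"
  unfolding stars_def by blast

lemma stars_component:
  "stars R A \<Longrightarrow> a \<in> A \<Longrightarrow> e \<in> R \<Longrightarrow> a \<in> e \<Longrightarrow> f \<in> R \<Longrightarrow> f \<inter> e \<noteq> {} \<Longrightarrow> a \<in> f"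
  unfolding stars_def by blast

text \<open>Stars found after deleting \<open>A\<close> are components of \<open>R\<close> itself:
  by \<open>sep\<close>, no edge avoiding \<open>A\<close> touches an edge that meets
  \<open>A\<close>. Disjointness lets the numbers of centers add up.\<close>

lemma stars_Un:
  assumes "stars R A" "stars (avoiding R A) B"
  shows "stars R (A \<union> B)" "A \<inter> B = {}"
proof -
  have in_avoiding: "e \<in> avoiding R A \<longleftrightarrow> e \<in> R \<and> e \<inter> A = {}" for e
    by (simp add: avoiding_def disjnt_def)
  have sep: "f \<inter> A = {}" if "e \<in> avoiding R A" "f \<in> R" "f \<inter> e \<noteq> {}" for e f
  proof (rule ccontr)
    assume "f \<inter> A \<noteq> {}"
    then obtain a where "a \<in> f" "a \<in> A" by blast
    then have "a \<in> e"
      using stars_component[OF assms(1), of a f e] that by (auto simp: in_avoiding)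
    then show False using that \<open>a \<in> A\<close> by (auto simp: in_avoiding)
  qed
  have B: "f \<inter> A = {}" if "f \<in> R" "b \<in> f" "b \<in> B" for f b
  proof -
    obtain e where "e \<in> avoiding R A" "b \<in> e" using stars_edge[OF assms(2) \<open>b \<in> B\<close>] by blast
    then show ?thesis using sep[of e f] that by blast
  qed
  show "A \<inter> B = {}"
  proof (rule ccontr)
    assume "A \<inter> B \<noteq> {}"
    then obtain b where "b \<in> A" "b \<in> B" by blast
    then show False using stars_edge[OF assms(2), of b] by (auto simp: in_avoiding)
  qed
  show "stars R (A \<union> B)"
    unfolding stars_def
  proof (intro ballI conjI impI)
    fix a assume a: "a \<in> A \<union> B"
    then show "\<exists>e\<in>R. a \<in> e"
      using stars_edge[OF assms(1)] stars_edge[OF assms(2)] avoiding_subset by blast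
    fix e assume e: "e \<in> R" "a \<in> e"
    show "e \<inter> (A \<union> B) = {a}"
    proof (cases "a \<in> A")
      case True
      moreover have "e \<inter> B = {}" using B e True by blast
      ultimately show ?thesis using stars_Int[OF assms(1) True e] by blast
    next
      case False
      then have "a \<in> B" "e \<in> avoiding R A" using a B e by (auto simp: in_avoiding)
      then show ?thesis using stars_Int[OF assms(2), of a e] e by (auto simp: in_avoiding)
    qed
    fix f assume f: "f \<in> R" "f \<inter> e \<noteq> {}"
    show "a \<in> f"
    proof (cases "a \<in> A")
      case True
      then show ?thesis using stars_component[OF assms(1) True e f] by blast
    next
      case False
      then have "a \<in> B" "e \<in> avoiding R A" using a B e by (auto simp: in_avoiding)
      moreover have "f \<in> avoiding R A" using sep calculation f by (simp add: in_avoiding)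
      ultimately show ?thesis using stars_component[OF assms(2), of a e f] e f by blast
    qed
  qed
qed

text \<open>A star whose center is not on \<open>e\<close> is disjoint from \<open>e\<close>, so it
  survives intact.\<close>

lemma stars_play:
  assumes "stars R A" "e \<in> R"
  shows "stars (avoiding R e) (A - e)"
  unfolding stars_def
proof (intro ballI conjI impI)
  fix a assume a: "a \<in> A - e"
  then obtain g where g: "g \<in> R" "a \<in> g" using stars_edge[OF assms(1)] by blast
  then have "g \<inter> e = {}"
    using stars_component[OF assms(1), of a g e] a assms(2) by blast
  then show "\<exists>e\<in>avoiding R e. a \<in> e" using g by (auto simp: avoiding_def disjnt_def)
  fix f assume f: "f \<in> avoiding R e" "a \<in> f"
  then have "f \<in> R" using avoiding_subset by blast
  then have "f \<inter> A = {a}" using stars_Int[OF assms(1)] a f by blast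
  then show "f \<inter> (A - e) = {a}" using a by blast
  fix h assume "h \<in> avoiding R e" "h \<inter> f \<noteq> {}"
  then show "a \<in> h"
    using stars_component[OF assms(1), of a f h] a f \<open>f \<in> R\<close> avoiding_subset by blast
qed

text \<open>The edges meeting \<open>e\<close> are exactly those of its star. The move thus trades
  one center for one chosen edge and leaves the rest unchanged.\<close>

lemma stars_play_star:
  assumes "stars R A" "e \<in> R" "\<not> disjnt e A" "finite A"
  shows "Suc (card (A - e)) = card A" "avoiding (avoiding R e) (A - e) = avoiding R A"
proof -
  obtain a where a: "a \<in> e" "a \<in> A" using assms(3) by (auto simp: disjnt_def)
  then have eA: "e \<inter> A = {a}" using stars_Int assms by metis
  then have "A - e = A - {a}" by blast
  then show "Suc (card (A - e)) = card A"
    using a assms(4) card.remove by fastforce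
  have "a \<in> f" if "f \<in> R" "f \<inter> e \<noteq> {}" for f
    using stars_component[OF assms(1) a(2) assms(2) a(1)] that by blast
  then show "avoiding (avoiding R e) (A - e) = avoiding R A"
    using a eA by (fastforce simp: avoiding_def disjnt_def)
qed

section \<open>Moves and values of the game\<close>

text \<open>Legal moves form the remaining forest, and a move deletes its two ends. Size 2 excludes
  the empty edge, which would be disjoint from itself.\<close>

lemma legal_moves_insert:
  assumes "e \<in> legal_moves E M" "\<forall>e\<in>E. card e = 2"
  shows "legal_moves E (insert e M) = avoiding (legal_moves E M) e"
proof -
  have "f \<noteq> {}" if "f \<in> E" for f using assms(2) that by auto
  then show ?thesis
    using assms(1)
    by (auto simp: legal_moves_def avoiding_def matching_def pairwise_insert disjnt_sym)
qed

lemma game_value_terminal: "legal_moves E M = {} \<Longrightarrow> game_value E p M = card M"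
  by (subst game_value.simps) simp

lemma game_value_Maximizer_ge:
  assumes "finite E" "e \<in> legal_moves E M"
  shows "game_value E Minimizer (insert e M) \<le> game_value E Maximizer M"
proof -
  have "finite (legal_moves E M)" using assms(1) by (auto simp: legal_moves_def)
  then show ?thesis
    using assms by (subst (2) game_value.simps) (auto intro!: Max_ge)
qed

lemma game_value_Minimizer_attained:
  assumes "finite E" "legal_moves E M \<noteq> {}"
  obtains e where "e \<in> legal_moves E M" "game_value E Minimizer M = game_value E Maximizer (insert e M)"
proof -
  have "finite (legal_moves E M)" using assms(1) by (auto simp: legal_moves_def)
  then have "Min ((\<lambda>e. game_value E Maximizer (insert e M)) ` legal_moves E M)
      \<in> (\<lambda>e. game_value E Maximizer (insert e M)) ` legal_moves E M"
    using assms(2) by (intro Min_in) auto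
  then show thesis
    using that assms by (auto simp: game_value.simps[of E Minimizer M])
qed

section \<open>The potential along the game\<close>

text \<open>The quantity of the overview, for any set \<open>A\<close> of centers, not necessarily
  of all stars. In a terminal position with \<open>A = {}\<close> it is four times the final
  size.\<close>

definition guarantee :: "'a set set \<Rightarrow> 'a set set \<Rightarrow> 'a set \<Rightarrow> nat" where
  "guarantee E M A =
     4 * card M + 4 * card A + 3 * matching_number (avoiding (legal_moves E M) A)"

lemma stars_finite:
  assumes "stars R A" "finite R" "\<forall>e\<in>R. card e = 2"
  shows "finite A"
proof (rule finite_subset)
  show "A \<subseteq> \<Union>R" using assms(1) by (auto simp: stars_def)
  show "finite (\<Union>R)" using assms by (metis card.infinite finite_Union zero_neq_numeral)
qed

lemma card_insert_legal:
  "finite E \<Longrightarrow> e \<in> legal_moves E M \<Longrightarrow> card (insert e M) = Suc (card M)"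
  by (subst card_insert_disjoint) (auto simp: legal_moves_def matching_def intro: finite_subset)

text \<open>An answer inside a star of \<open>A\<close> keeps the potential, any other costs at most
  2 and requires a nonempty rest. \<open>IH\<close> is an assumption so that the lemma can be
  applied within the induction for Maximizer.\<close>

lemma guarantee_Minimizer:
  assumes "finite E" and two: "\<forall>e\<in>E. card e = 2"
    and st: "stars (legal_moves E M) A"
    and IH: "\<And>e B. e \<in> legal_moves E M \<Longrightarrow> stars (legal_moves E (insert e M)) B \<Longrightarrow>
      guarantee E (insert e M) B \<le> 4 * game_value E Maximizer (insert e M)"
  shows "guarantee E M A \<le> 4 * game_value E Minimizer M + 2"
    and "avoiding (legal_moves E M) A = {} \<Longrightarrow> guarantee E M A \<le> 4 * game_value E Minimizer M"
proof -
  let ?R = "legal_moves E M"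
  have RE: "?R \<subseteq> E" by (auto simp: legal_moves_def)
  have finA: "finite A"
    using stars_finite[OF st] RE assms(1) two by (meson finite_subset subsetD)
  have "guarantee E M A \<le> 4 * game_value E Minimizer M + 2 \<and>
    (avoiding ?R A = {} \<longrightarrow> guarantee E M A \<le> 4 * game_value E Minimizer M)"
  proof (cases "?R = {}")
    case True
    then have "A = {}" using st by (auto simp: stars_def)
    then show ?thesis using True by (simp add: guarantee_def game_value_terminal avoiding_def)
  next
    case False
    then obtain e where e: "e \<in> ?R"
        "game_value E Minimizer M = game_value E Maximizer (insert e M)"
      using game_value_Minimizer_attained assms(1) by blast
    have R': "legal_moves E (insert e M) = avoiding ?R e" using legal_moves_insert e two by blast
    then have ge: "guarantee E (insert e M) (A - e) \<le> 4 * game_value E Minimizer M"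
      using IH[OF e(1), of "A - e"] stars_play[OF st e(1)] e(2) by simp
    have g: "guarantee E (insert e M) (A - e) = 4 + 4 * card M + 4 * card (A - e) +
        3 * matching_number (avoiding (avoiding ?R e) (A - e))"
      using card_insert_legal[OF assms(1) e(1)] R' by (simp add: guarantee_def)
    show ?thesis
    proof (cases "disjnt e A")
      case False
      then show ?thesis
        using stars_play_star[OF st e(1) False finA] ge g by (simp add: guarantee_def)
    next
      case True
      then have A: "A - e = A" by (auto simp: disjnt_def)
      have eE: "e \<in> E" "card e = 2" "finite e" using e RE two by (auto intro!: card_ge_0_finite)
      \<comment> \<open>The two ends of \<open>e\<close> cover what is deleted: a loss of at most 3
        * 2 against a gain of 4 for the chosen edge.\<close>
      have "matching_number (avoiding ?R A) \<le> card e + matching_number (avoiding (avoiding ?R e) A)"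
      proof (rule matching_number_le_cover)
        show "finite (avoiding ?R A)"
          using assms(1) RE avoiding_subset by (metis finite_subset)
      qed (use eE in \<open>auto simp: avoiding_def\<close>)
      moreover have "e \<in> avoiding ?R A" using True e by (auto simp: avoiding_def)
      ultimately show ?thesis using ge g A eE by (auto simp: guarantee_def)
    qed
  qed
  then show "guarantee E M A \<le> 4 * game_value E Minimizer M + 2"
    and "avoiding ?R A = {} \<Longrightarrow> guarantee E M A \<le> 4 * game_value E Minimizer M"
    by auto
qed

text \<open>The outer induction follows the game one full round at a time; the inner one fixes the
  position and moves stars from the rest into \<open>A\<close> until the rest is empty or not a
  union of stars.\<close>

lemma guarantee_Maximizer:
  assumes "finite E" and two: "\<forall>e\<in>E. card e = 2" and acyclic: "\<nexists>vs. is_cycle E vs"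
    and "stars (legal_moves E M) A"
  shows "guarantee E M A \<le> 4 * game_value E Maximizer M"
  using assms(4)
proof (induction "card (legal_moves E M)" arbitrary: M A rule: less_induct)
  case less
  let ?R = "legal_moves E M"
  have RE: "?R \<subseteq> E" by (auto simp: legal_moves_def)
  have finR: "finite ?R" using RE assms(1) finite_subset by blast
  have legal: "legal_moves E (insert e M) = avoiding ?R e" if "e \<in> ?R" for e
    using legal_moves_insert that two by blast
  have smaller: "card (legal_moves E (insert e M)) < card (legal_moves E M)"
    if "e \<in> legal_moves E M" for e M
  proof (rule psubset_card_mono)
    show "finite (legal_moves E M)" using assms(1) by (auto simp: legal_moves_def)
    have "\<not> disjnt e e" using that two by (auto simp: legal_moves_def)
    then have "e \<notin> legal_moves E (insert e M)"
      by (simp add: legal_moves_insert[OF that two] avoiding_def)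
    then show "legal_moves E (insert e M) \<subset> legal_moves E M"
      using that avoiding_subset legal_moves_insert[OF that two] by blast
  qed
  have IH: "guarantee E (insert f (insert e M)) B
      \<le> 4 * game_value E Maximizer (insert f (insert e M))"
    if "e \<in> ?R" "f \<in> legal_moves E (insert e M)"
      "stars (legal_moves E (insert f (insert e M))) B" for e f B
    using that less.hyps smaller by (meson less_trans)
  show ?case
    using less.prems
  proof (induction "card (avoiding ?R A)" arbitrary: A rule: less_induct)
    case (less A)
    note st = less.prems
    let ?U = "avoiding ?R A"
    have finA: "finite A"
      using stars_finite[OF st finR] RE two by blast
    have UE: "?U \<subseteq> E" using RE by (auto simp: avoiding_def)
    then have U: "finite ?U" "\<forall>e\<in>?U. card e = 2" "\<nexists>vs. is_cycle ?U vs"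
      using assms(1) two acyclic is_cycle_mono by (blast intro: finite_subset)+
    consider "?R = {}" | "?R \<noteq> {}" "?U = {}" | "?U \<noteq> {}" "peel ?U = {}" | "peel ?U \<noteq> {}"
      by blast
    then show ?case
    proof cases
      case 1
      then have "A = {}" using st by (auto simp: stars_def)
      then show ?thesis using 1 by (simp add: guarantee_def game_value_terminal avoiding_def)
    next
      case 2
      then obtain e where e: "e \<in> ?R" by blast
      then have hit: "\<not> disjnt e A" using 2 by (auto simp: avoiding_def)
      note s = stars_play_star[OF st e hit finA]
      \<comment> \<open>Only stars remain, and they still do after the move, so the bound without
        the loss of 2 applies.\<close>
      have "guarantee E (insert e M) (A - e) \<le> 4 * game_value E Minimizer (insert e M)"
      proof (rule guarantee_Minimizer(2)[OF assms(1) two])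
        show "stars (legal_moves E (insert e M)) (A - e)"
          using stars_play[OF st e] legal[OF e] by simp
        show "avoiding (legal_moves E (insert e M)) (A - e) = {}"
          using s(2) 2 legal[OF e] by simp
      qed (use IH e in auto)
      moreover have "guarantee E (insert e M) (A - e) = guarantee E M A"
        using s card_insert_legal[OF assms(1) e] legal[OF e] by (simp add: guarantee_def)
      ultimately show ?thesis using game_value_Maximizer_ge[OF assms(1) e] by linarith
    next
      case 3
      \<comment> \<open>No move is made: counting one more star gains 4 and costs at most 3.\<close>
      then obtain v where v: "stars ?U {v}"
          "matching_number ?U \<le> 1 + matching_number (avoiding ?U {v})"
        using star_forest_split[OF U(1) _ U(2,3)] by blast
      note un = stars_Un[OF st v(1)]
      obtain e where "e \<in> ?U" "v \<in> e" using v(1) by (auto simp: stars_def)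
      then have "avoiding ?R (A \<union> {v}) \<subset> ?U"
        by (auto simp: avoiding_def)
      then have "guarantee E M (A \<union> {v}) \<le> 4 * game_value E Maximizer M"
        using less.hyps un(1) U(1) by (meson psubset_card_mono)
      moreover have "card (A \<union> {v}) = card A + 1" using un(2) finA by simp
      ultimately show ?thesis
        using v(2) by (simp add: guarantee_def avoiding_avoiding)
    next
      case 4
      then obtain e B where e: "e \<in> ?U" and B: "finite B" "B \<noteq> {}" "stars (avoiding ?U e) B"
        "matching_number ?U \<le> 1 + card B + matching_number (avoiding (avoiding ?U e) B)"
        using forest_split[OF U(1) _ U(2,3)] by blast
      have eR: "e \<in> ?R" and Ae: "A - e = A" using e by (auto simp: avoiding_def disjnt_def)
      have swap: "avoiding ?U e = avoiding (avoiding ?R e) A"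
        by (simp add: avoiding_avoiding Un_commute)
      have st': "stars (avoiding ?R e) A" using stars_play[OF st eR] Ae by simp
      note un = stars_Un[OF st' B(3)[unfolded swap]]
      have "guarantee E (insert e M) (A \<union> B) \<le> 4 * game_value E Minimizer (insert e M) + 2"
        by (rule guarantee_Minimizer(1)[OF assms(1) two]) (use IH eR un legal[OF eR] in auto)
      moreover have "guarantee E (insert e M) (A \<union> B) = 4 + 4 * card M + 4 * card A + 4 * card B +
          3 * matching_number (avoiding (avoiding ?U e) B)"
        using card_insert_legal[OF assms(1) eR] legal[OF eR] un(2) finA B(1)
        by (simp add: guarantee_def card_Un_disjoint swap avoiding_avoiding Un_ac)
      \<comment> \<open>The move gains at least
        \<open>4 + 4 * card B - 3 * (1 + card B) = 1 + card B\<close>, and one new star makes this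
        at least the 2 that Minimizer can take back.\<close>
      moreover have "1 \<le> card B" using B by (simp add: Suc_leI card_gt_0_iff)
      ultimately have "guarantee E M A \<le> 4 * game_value E Minimizer (insert e M)"
        using B(4) unfolding guarantee_def by linarith
      then show ?thesis using game_value_Maximizer_ge[OF assms(1) eR] by linarith
    qed
  qed
qed

theorem theorem4p1:
  fixes V :: "'a set" and E :: "'a set set"
  assumes "forest V E"
  shows "real (game_matching_number E) \<ge> 3 / 4 * real (matching_number E)"
proof -
  have E: "finite V" "E \<subseteq> nsets V 2" "\<nexists>vs. is_cycle E vs"
    using assms by (auto simp: forest_def fin_simple_graph_def)
  then have fin: "finite E" by (meson finite_imp_finite_nsets finite_subset)
  have two: "\<forall>e\<in>E. card e = 2" using E(2) by (auto simp: nsets_def)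
  \<comment> \<open>With no edge chosen and no center, the potential is
    \<open>3 * matching_number E\<close>.\<close>
  have "legal_moves E {} = E" by (auto simp: legal_moves_def matching_def)
  moreover have "stars E {}" by (simp add: stars_def)
  ultimately have "3 * matching_number E \<le> 4 * game_matching_number E"
    using guarantee_Maximizer[OF fin two E(3), of "{}" "{}"]
    by (simp add: guarantee_def game_matching_number_def avoiding_def)
  then show ?thesis by linarith
qed

end
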